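(* Let $p,q\in\Bbbk[t]$ be nonzero, coprime polynomials, and assume that $q$ is monic. Then the rational function $x(t)=q(t)/p(t)$ is a solution of $x'=A_3(t)x^{n_3}+A_2(t)x^{n_2}+A_1(t)x^{n_1}$ if and only if the following two conditions hold: (a) $q(t)\equiv 1$; (b) $p(t)^{n_3-2}p'(t)+A_3(t)+A_2(t)p(t)^{n_3-n_2}+A_1(t)p(t)^{n_3-n_1}\equiv 0$.
   Context: $\Bbbk\in\{\mathbb{R},\mathbb{C}\}$; $n_1,n_2,n_3$ are natural numbers with $1<n_1<n_2<n_3$; $A_1,A_2,A_3\in\Bbbk[t]$ are nonzero polynomials. A rational function $x\in\Bbbk(t)$ is a solution if the differential equation holds as an identity in $\Bbbk(t)$. *)

theory Defs
  imports Complex_Main "HOL-Computational_Algebra.Polynomial_Factorial"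
begin

text \<open>The field of rational functions \<open>\<bbbk>(t)\<close> is the fraction field \<open>'a poly fract\<close>, with
  \<^const>\<open>to_fract\<close> as the embedding of \<open>\<bbbk>[t]\<close>. The derivative of a rational function is given
  by the quotient rule, applied to any representative; \<open>ratfun_deriv_Fract\<close> below shows that
  the result does not depend on the representative.\<close>

definition ratfun_deriv :: "'a::field poly fract \<Rightarrow> 'a poly fract"
  where "ratfun_deriv x = (THE y. \<exists>a b. b \<noteq> 0 \<and> x = Fract a b \<and>
           y = Fract (pderiv a * b - a * pderiv b) (b ^ 2))"

lemma quotient_rule_well_defined:
  fixes a b c d :: "'a::field poly"
  assumes "b \<noteq> 0" "d \<noteq> 0" "Fract a b = Fract c d"
  shows "Fract (pderiv a * b - a * pderiv b) (b ^ 2) = Fract (pderiv c * d - c * pderiv d) (d ^ 2)"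
proof -
  have ad: "a * d = c * b" using assms by (simp add: eq_fract)
  have "pderiv (a * d) = pderiv (c * b)" using ad by simp
  then have deriv: "pderiv a * d = c * pderiv b + b * pderiv c - a * pderiv d"
    by (simp add: pderiv_mult algebra_simps)
  have "(pderiv a * b - a * pderiv b) * d\<^sup>2
      = b * d * (pderiv a * d) - (a * d) * pderiv b * d"
    by (simp add: algebra_simps power2_eq_square)
  also have "\<dots> = b * d * (c * pderiv b + b * pderiv c) - b * pderiv d * (a * d)
      - (a * d) * pderiv b * d"
    unfolding deriv by (simp add: algebra_simps)
  also have "\<dots> = (pderiv c * d - c * pderiv d) * b\<^sup>2"
    unfolding ad by (simp add: algebra_simps power2_eq_square)
  finally show ?thesis using assms by (simp add: eq_fract)
qed

lemma ratfun_deriv_Fract: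
  fixes a b :: "'a::field poly"
  assumes "b \<noteq> 0"
  shows "ratfun_deriv (Fract a b) = Fract (pderiv a * b - a * pderiv b) (b ^ 2)"
  unfolding ratfun_deriv_def
proof (rule the_equality)
  show "\<exists>c d. d \<noteq> 0 \<and> Fract a b = Fract c d \<and>
          Fract (pderiv a * b - a * pderiv b) (b ^ 2) = Fract (pderiv c * d - c * pderiv d) (d ^ 2)"
    using assms by blast
qed (use quotient_rule_well_defined[OF assms] in metis)

lemma ratfun_deriv_to_fract: "ratfun_deriv (to_fract a) = to_fract (pderiv a)"
  by (simp add: to_fract_def ratfun_deriv_Fract)

definition rational_solution ::
  "nat \<Rightarrow> nat \<Rightarrow> nat \<Rightarrow> 'a::field poly \<Rightarrow> 'a poly \<Rightarrow> 'a poly \<Rightarrow> 'a poly fract \<Rightarrow> bool"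
where
  "rational_solution n1 n2 n3 A1 A2 A3 x \<longleftrightarrow>
     ratfun_deriv x = to_fract A3 * x ^ n3 + to_fract A2 * x ^ n2 + to_fract A1 * x ^ n1"

end

theory Submission
  imports Defs "HOL-Computational_Algebra.Field_as_Ring"
begin

text \<open>Clearing denominators turns the equation into the polynomial identity
  \<open>p\<^bsup>n3-2\<^esup> (q' p - q p') = A3 q\<^bsup>n3\<^esup> + A2 q\<^bsup>n2\<^esup> p\<^bsup>n3-n2\<^esup> + A1 q\<^bsup>n1\<^esup> p\<^bsup>n3-n1\<^esup>\<close>.
  Its right-hand side is divisible by \<open>q\<close> because \<open>n1 > 0\<close>, so coprimality yields that \<open>q\<close> divides
  \<open>q'\<close>. In characteristic zero \<open>q\<close> is then constant, hence \<open>1\<close> by monicity, and for \<open>q = 1\<close> the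
  polynomial identity is condition (b).\<close>

text \<open>In characteristic zero a nonconstant polynomial has a nonzero derivative of smaller
  degree, which it cannot divide.\<close>

lemma degree_eq_0_if_dvd_pderiv:
  fixes q :: "'a::field_char_0 poly"
  assumes "q dvd pderiv q"
  shows "degree q = 0"
proof (rule ccontr)
  assume "degree q \<noteq> 0"
  then have "pderiv q \<noteq> 0" and "degree (pderiv q) < degree q"
    by (simp_all add: pderiv_eq_0_iff degree_pderiv)
  then show False
    using dvd_imp_degree_le[OF assms] by simp
qed

text \<open>Multiplying by the nonzero \<open>P ^ n3\<close> is reversible and clears every
  denominator; the resulting identity descends to polynomials because \<open>to_fract\<close> is
  injective.\<close>

lemma rational_solution_Fract_iff:
  fixes p q A1 A2 A3 :: "'a::field poly"
  assumes "2 \<le> n3" "n1 \<le> n3" "n2 \<le> n3" "p \<noteq> 0"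
  shows "rational_solution n1 n2 n3 A1 A2 A3 (to_fract q / to_fract p) \<longleftrightarrow>
    p ^ (n3 - 2) * (pderiv q * p - q * pderiv p) =
      A3 * q ^ n3 + A2 * q ^ n2 * p ^ (n3 - n2) + A1 * q ^ n1 * p ^ (n3 - n1)"
    (is "?sol \<longleftrightarrow> ?L = ?R")
proof -
  define P Q where "P = to_fract p" and "Q = to_fract q"
  have P: "P \<noteq> 0"
    using assms by (simp add: P_def)
  have clear: "(Q / P) ^ n * P ^ n3 = Q ^ n * P ^ (n3 - n)" if "n \<le> n3" for n
    using P that by (simp add: power_divide power_diff)
  have pow: "to_fract (a ^ n) = to_fract a ^ n" for a :: "'a poly" and n
    by (induction n) simp_all
  have deriv: "ratfun_deriv (Q / P) = to_fract (pderiv q * p - q * pderiv p) / P ^ 2"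
    using assms by (simp add: P_def Q_def to_fract_def ratfun_deriv_Fract power2_eq_square)
  have "?sol \<longleftrightarrow> ratfun_deriv (Q / P) * P ^ n3 =
      (to_fract A3 * (Q / P) ^ n3 + to_fract A2 * (Q / P) ^ n2 + to_fract A1 * (Q / P) ^ n1) * P ^ n3"
    using P by (simp add: rational_solution_def P_def Q_def)
  \<comment> \<open>The square from the quotient rule cancels; \<open>2 \<le> n3\<close> makes the
    natural number \<open>n3 - 2\<close> the true difference.\<close>
  also have "ratfun_deriv (Q / P) * P ^ n3 = to_fract ?L"
    using P assms(1) by (simp add: deriv pow P_def[symmetric] power_diff)
  also have "(to_fract A3 * (Q / P) ^ n3 + to_fract A2 * (Q / P) ^ n2 + to_fract A1 * (Q / P) ^ n1) * P ^ n3
      = to_fract ?R"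
    unfolding distrib_right mult.assoc
    by (simp add: clear assms pow P_def[symmetric] Q_def[symmetric])
  finally show ?thesis
    by (simp only: to_fract_eq_iff)
qed

text \<open>The sort \<open>field_gcd\<close> equips polynomials with gcds, so that coprime factors
  can be cancelled in divisibilities; \<open>real\<close> and \<open>complex\<close> both have this
  sort.\<close>

lemma rational_solution_iff:
  fixes p q A1 A2 A3 :: "'a::{field_char_0,field_gcd} poly"
  assumes "0 < n1" "2 \<le> n3" "n1 \<le> n2" "n2 \<le> n3"
    and "p \<noteq> 0" "coprime p q" "lead_coeff q = 1"
  shows "rational_solution n1 n2 n3 A1 A2 A3 (to_fract q / to_fract p) \<longleftrightarrow>
    q = 1 \<and> p ^ (n3 - 2) * pderiv p + A3 + A2 * p ^ (n3 - n2) + A1 * p ^ (n3 - n1) = 0"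
    (is "?sol \<longleftrightarrow> q = 1 \<and> ?eq = 0")
proof -
  let ?W = "pderiv q * p - q * pderiv p"
  have cleared: "?sol \<longleftrightarrow> p ^ (n3 - 2) * ?W =
      A3 * q ^ n3 + A2 * q ^ n2 * p ^ (n3 - n2) + A1 * q ^ n1 * p ^ (n3 - n1)"
    using assms by (intro rational_solution_Fract_iff) auto
  have "q = 1" if ?sol
  proof -
    have "q dvd p ^ (n3 - 2) * ?W"
      using that assms(1-4) unfolding cleared
      by (simp add: dvd_power)
    moreover have "coprime q (p ^ (n3 - 2))"
      using assms(6) by (simp add: coprime_commute)
    ultimately have "q dvd ?W"
      by (simp add: coprime_dvd_mult_right_iff)
    \<comment> \<open>The other summand of \<open>?W\<close> is a multiple of
      \<open>q\<close>.\<close>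
    then have "q dvd pderiv q * p"
      by (simp add: dvd_diff_left_iff)
    then have "q dvd pderiv q"
      using assms(6) by (simp add: coprime_dvd_mult_left_iff coprime_commute)
    then have "degree q = 0"
      by (rule degree_eq_0_if_dvd_pderiv)
    then show "q = 1"
      using assms(7) by (auto elim: degree_eq_zeroE)
  qed
  moreover have "?sol \<longleftrightarrow> ?eq = 0" if "q = 1"
  proof -
    \<comment> \<open>For \<open>q = 1\<close> the derivative of \<open>q\<close> vanishes, so
      \<open>?W\<close> is \<open>- pderiv p\<close>.\<close>
    have "?sol \<longleftrightarrow> - (p ^ (n3 - 2) * pderiv p) = A3 + A2 * p ^ (n3 - n2) + A1 * p ^ (n3 - n1)"
      unfolding cleared by (simp add: that)
    then show ?thesis
      by (simp add: neg_eq_iff_add_eq_0 add.assoc)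
  qed
  ultimately show ?thesis
    by blast
qed

theorem proposition2p1:
  fixes n1 n2 n3 :: nat
  assumes "1 < n1" and "n1 < n2" and "n2 < n3"
  shows "(\<forall>A1 A2 A3 p q :: real poly.
           A1 \<noteq> 0 \<longrightarrow> A2 \<noteq> 0 \<longrightarrow> A3 \<noteq> 0 \<longrightarrow> p \<noteq> 0 \<longrightarrow> q \<noteq> 0 \<longrightarrow>
           coprime p q \<longrightarrow> lead_coeff q = 1 \<longrightarrow>
           (rational_solution n1 n2 n3 A1 A2 A3 (to_fract q / to_fract p) \<longleftrightarrow>
              q = 1 \<and>
              p ^ (n3 - 2) * pderiv p + A3 + A2 * p ^ (n3 - n2) + A1 * p ^ (n3 - n1) = 0)) \<and>
         (\<forall>A1 A2 A3 p q :: complex poly.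
           A1 \<noteq> 0 \<longrightarrow> A2 \<noteq> 0 \<longrightarrow> A3 \<noteq> 0 \<longrightarrow> p \<noteq> 0 \<longrightarrow> q \<noteq> 0 \<longrightarrow>
           coprime p q \<longrightarrow> lead_coeff q = 1 \<longrightarrow>
           (rational_solution n1 n2 n3 A1 A2 A3 (to_fract q / to_fract p) \<longleftrightarrow>
              q = 1 \<and>
              p ^ (n3 - 2) * pderiv p + A3 + A2 * p ^ (n3 - n2) + A1 * p ^ (n3 - n1) = 0))"
  using assms by (intro conjI allI impI rational_solution_iff) simp_all

end
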